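(* For the reinforcement-learning signaling process with $M_1$ states, $M_2$ signals and $M_1$ acts described in the context, the communication potential process $(H(x_n))_{n\in\mathbb{N}}$ is a bounded submartingale (with respect to the filtration $(\mathcal{F}_n)_{n\in\mathbb{N}}$), and hence converges almost surely.
   Context: Model. Let $M_1,M_2\ge 1$ be integers, let $\mathcal{S}_1,\mathcal{S}_2$ be disjoint finite sets with $|\mathcal{S}_1|=M_1$ (states, which are also the acts) and $|\mathcal{S}_2|=M_2$ (signals), and $\mathcal{S}=\mathcal{S}_1\cup\mathcal{S}_2$. The random process $V(n,i,j)$, $n\in\mathbb{N}=\{0,1,2,\dots\}$, $i\in\mathcal{S}_1$, $j\in\mathcal{S}_2$, starts from $V(0,i,j)=1$ for all $i,j$. At each step, given the past up to time $n$: a state $i\in\mathcal{S}_1$ is drawn uniformly (probability $1/M_1$ each), independently of the past; Sender then chooses signal $j\in\mathcal{S}_2$ with probability $V(n,i,j)/\sum_{l\in\mathcal{S}_2}V(n,i,l)$; then Receiver, seeing only $j$, chooses an act $k\in\mathcal{S}_1$ with probability $V(n,k,j)/\sum_{l\in\mathcal{S}_1}V(n,l,j)$. If $k=i$, then $V(n+1,i,j)=V(n,i,j)+1$ and all other entries are unchanged; if $k\ne i$, no entry changes. Notation. Extend $V$ symmetrically to $\mathcal{S}\times\mathcal{S}$: $V(n,j,i)=V(n,i,j)$ for $i\in\mathcal{S}_1,j\in\mathcal{S}_2$, and $V(n,i,j)=0$ if $i,j$ are both in $\mathcal{S}_1$ or both in $\mathcal{S}_2$. Let $T_n^i=\sum_{j\in\mathcal{S}}V(n,i,j)$,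 $T_n=\sum_{i\in\mathcal{S}_1}T_n^i$, $x_{ij}^n=V(n,i,j)/T_n$, $x_n=(x_{ij}^n)_{i,j\in\mathcal{S}}$, and $\mathcal{F}_n=\sigma(x_1,\dots,x_n)$. The process $x_n$ takes values in the simplex $\Delta$ of symmetric arrays $(x_{ij})_{i,j\in\mathcal{S}}$ with $x_{ij}=x_{ji}\ge0$, $x_{ij}=0$ if $i,j$ are in the same part, and $\sum_{i\in\mathcal{S}_1,j\in\mathcal{S}_2}x_{ij}=1$. For $x\in\Delta$, $x_i=\sum_{j\in\mathcal{S}}x_{ij}$, and the communication potential is $H(x)=\sum_{i\in\mathcal{S}_1,\,j\in\mathcal{S}_2:\,x_{ij}>0}\frac{x_{ij}^2}{x_ix_j}$. *)

theory Defs
  imports "HOL-Probability.Probability"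
begin

section \<open>Submartingales\<close>

definition submartingale :: "'w measure \<Rightarrow> (nat \<Rightarrow> 'w measure) \<Rightarrow> (nat \<Rightarrow> 'w \<Rightarrow> real) \<Rightarrow> bool" where
  "submartingale M F X \<longleftrightarrow>
     filtration (space M) F \<and>
     (\<forall>n. subalgebra M (F n)) \<and>
     (\<forall>n. X n \<in> borel_measurable (F n)) \<and>
     (\<forall>n. integrable M (X n)) \<and>
     (\<forall>n. AE w in M. X n w \<le> real_cond_exp M (F n) (X (Suc n)) w)"

definition bounded_process :: "'w measure \<Rightarrow> (nat \<Rightarrow> 'w \<Rightarrow> real) \<Rightarrow> bool" where
  "bounded_process M X \<longleftrightarrow> (\<exists>C. \<forall>n. \<forall>w\<in>space M. \<bar>X n w\<bar> \<le> C)"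


section \<open>Histories of array-valued processes\<close>

text \<open>
  A family of random arrays X m, for times m in I and with index pairs in A, is viewed as one
  random element of a product of product spaces; the restrictions make its values extensional,
  as the product measure space requires.  The sigma-algebra generated by a random element Z with
  values in N is \<open>vimage_algebra (space M) Z N\<close>.
\<close>

definition array_history ::
    "nat set \<Rightarrow> ('s \<times> 's) set \<Rightarrow> (nat \<Rightarrow> 'w \<Rightarrow> 's \<Rightarrow> 's \<Rightarrow> real) \<Rightarrow> 'w \<Rightarrow> (nat \<Rightarrow> 's \<times> 's \<Rightarrow> real)" where
  "array_history I A X w = (\<lambda>m\<in>I. \<lambda>p\<in>A. X m w (fst p) (snd p))"

definition array_history_space ::
    "nat set \<Rightarrow> ('s \<times> 's) set \<Rightarrow> (nat \<Rightarrow> 's \<times> 's \<Rightarrow> real) measure" where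
  "array_history_space I A = (\<Pi>\<^sub>M m\<in>I. \<Pi>\<^sub>M p\<in>A. borel)"

definition array_history_algebra ::
    "'w measure \<Rightarrow> nat set \<Rightarrow> ('s \<times> 's) set \<Rightarrow> (nat \<Rightarrow> 'w \<Rightarrow> 's \<Rightarrow> 's \<Rightarrow> real) \<Rightarrow> 'w measure" where
  "array_history_algebra M I A X =
     vimage_algebra (space M) (array_history I A X) (array_history_space I A)"


section \<open>The signaling process\<close>

text \<open>
  \<open>V n w i j\<close> is the weight V(n,i,j) at the sample point \<open>w\<close>, constrained only for
  \<open>i \<in> S1\<close> and \<open>j \<in> S2\<close>.  The variables \<open>st n\<close>, \<open>sg n\<close> and \<open>act n\<close> are the state, the signal and
  the act of the step leading from time n to time n + 1.

  The past up to time n is the sigma-algebra generated by V(0), ..., V(n).  The conditional laws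
  with respect to a larger past to which V is adapted (such as the one that also records the
  earlier states, signals and acts) give the joint law of \<open>(st n, sg n, act n)\<close> conditional on this
  past, and hence the laws below.

  The signal is drawn conditionally on the past and the current state, the act conditionally on
  the past, the current state and the current signal; the probability of an act depends on the
  signal only, not on the state.
\<close>

locale signaling_process = prob_space M
  for M :: "'w measure" +
  fixes M1 M2 :: nat
    and S1 S2 :: "'s set"
    and V :: "nat \<Rightarrow> 'w \<Rightarrow> 's \<Rightarrow> 's \<Rightarrow> real"
    and st sg act :: "nat \<Rightarrow> 'w \<Rightarrow> 's"
  assumes M1_pos: "M1 \<ge> 1" and M2_pos: "M2 \<ge> 1"
    and finite_S1: "finite S1" and finite_S2: "finite S2"
    and card_S1: "card S1 = M1" and card_S2: "card S2 = M2"
    and disjoint: "S1 \<inter> S2 = {}"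
    and state_measurable: "\<And>n. st n \<in> M \<rightarrow>\<^sub>M count_space S1"
    and signal_measurable: "\<And>n. sg n \<in> M \<rightarrow>\<^sub>M count_space S2"
    and act_measurable: "\<And>n. act n \<in> M \<rightarrow>\<^sub>M count_space S1"
    and V_init: "\<And>w i j. w \<in> space M \<Longrightarrow> i \<in> S1 \<Longrightarrow> j \<in> S2 \<Longrightarrow> V 0 w i j = 1"
    and state_law: "\<And>n i. i \<in> S1 \<Longrightarrow>
      AE w in M. real_cond_exp M
          (array_history_algebra M {..n} (S1 \<times> S2) V)
          (indicator {u \<in> space M. st n u = i}) w
        = 1 / real M1"
    and signal_law: "\<And>n j. j \<in> S2 \<Longrightarrow>
      AE w in M. real_cond_exp M
          (vimage_algebra (space M) (\<lambda>u. (array_history {..n} (S1 \<times> S2) V u, st n u))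
             (array_history_space {..n} (S1 \<times> S2) \<Otimes>\<^sub>M count_space S1))
          (indicator {u \<in> space M. sg n u = j}) w
        = V n w (st n w) j / (\<Sum>l\<in>S2. V n w (st n w) l)"
    and act_law: "\<And>n k. k \<in> S1 \<Longrightarrow>
      AE w in M. real_cond_exp M
          (vimage_algebra (space M) (\<lambda>u. (array_history {..n} (S1 \<times> S2) V u, st n u, sg n u))
             (array_history_space {..n} (S1 \<times> S2) \<Otimes>\<^sub>M count_space S1 \<Otimes>\<^sub>M count_space S2))
          (indicator {u \<in> space M. act n u = k}) w
        = V n w k (sg n w) / (\<Sum>l\<in>S1. V n w l (sg n w))"
    and V_step: "\<And>n w i j. w \<in> space M \<Longrightarrow> i \<in> S1 \<Longrightarrow> j \<in> S2 \<Longrightarrow>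
      V (Suc n) w i j =
        (if act n w = st n w \<and> i = st n w \<and> j = sg n w then V n w i j + 1 else V n w i j)"


section \<open>Normalized process and communication potential\<close>

definition sym_ext :: "'s set \<Rightarrow> 's set \<Rightarrow> ('s \<Rightarrow> 's \<Rightarrow> real) \<Rightarrow> 's \<Rightarrow> 's \<Rightarrow> real" where
  "sym_ext S1 S2 v i j =
     (if i \<in> S1 \<and> j \<in> S2 then v i j
      else if i \<in> S2 \<and> j \<in> S1 then v j i
      else 0)"

text \<open>This is both the quantity T_n^i (for the extended array V) and the quantity x_i.\<close>

definition row_sum :: "'s set \<Rightarrow> 's set \<Rightarrow> ('s \<Rightarrow> 's \<Rightarrow> real) \<Rightarrow> 's \<Rightarrow> real" where
  "row_sum S1 S2 x i = (\<Sum>j\<in>S1 \<union> S2. x i j)"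

definition total_weight :: "'s set \<Rightarrow> 's set \<Rightarrow> ('s \<Rightarrow> 's \<Rightarrow> real) \<Rightarrow> real" where
  "total_weight S1 S2 x = (\<Sum>i\<in>S1. row_sum S1 S2 x i)"

definition normalized_process ::
    "'s set \<Rightarrow> 's set \<Rightarrow> (nat \<Rightarrow> 'w \<Rightarrow> 's \<Rightarrow> 's \<Rightarrow> real) \<Rightarrow> nat \<Rightarrow> 'w \<Rightarrow> 's \<Rightarrow> 's \<Rightarrow> real" where
  "normalized_process S1 S2 V n w i j =
     sym_ext S1 S2 (V n w) i j / total_weight S1 S2 (sym_ext S1 S2 (V n w))"

definition communication_potential :: "'s set \<Rightarrow> 's set \<Rightarrow> ('s \<Rightarrow> 's \<Rightarrow> real) \<Rightarrow> real" where
  "communication_potential S1 S2 x =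
     (\<Sum>(i, j) \<in> {(i, j). i \<in> S1 \<and> j \<in> S2 \<and> x i j > 0}.
        (x i j)\<^sup>2 / (row_sum S1 S2 x i * row_sum S1 S2 x j))"

text \<open>The sigma-algebra generated by x_1, ..., x_n; it is trivial for n = 0.\<close>

definition normalized_filtration ::
    "'w measure \<Rightarrow> 's set \<Rightarrow> 's set \<Rightarrow> (nat \<Rightarrow> 'w \<Rightarrow> 's \<Rightarrow> 's \<Rightarrow> real) \<Rightarrow> nat \<Rightarrow> 'w measure" where
  "normalized_filtration M S1 S2 V n =
     array_history_algebra M {1..n} ((S1 \<union> S2) \<times> (S1 \<union> S2)) (normalized_process S1 S2 V)"

end

theory Submission
  imports Defs
begin

text \<open>
  The potential is invariant under scaling, so it can be computed from the weights \<open>V\<close>, with row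
  sums \<open>R\<close> and column sums \<open>C\<close>: it is the sum of \<open>a\<^sub>i\<^sub>j = V\<^sub>i\<^sub>j\<^sup>2 / (R\<^sub>i C\<^sub>j)\<close>.  The entry \<open>(i, j)\<close> is reinforced
  with conditional probability \<open>a\<^sub>i\<^sub>j / M1\<close>, and \<open>M1\<close> times the conditional expected increment is exactly
  \<open>\<Sum>\<^sub>i\<^sub>j a\<^sub>i\<^sub>j (2 V\<^sub>i\<^sub>j + 1 + a\<^sub>i\<^sub>j) / ((R\<^sub>i + 1) (C\<^sub>j + 1)) - \<Sum>\<^sub>i (\<Sum>\<^sub>j a\<^sub>i\<^sub>j)\<^sup>2 / (R\<^sub>i + 1) - \<Sum>\<^sub>j (\<Sum>\<^sub>i a\<^sub>i\<^sub>j)\<^sup>2 / (C\<^sub>j + 1)\<close>,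
  which is nonnegative by Cauchy--Schwarz.  This drift is computed for the filtration of \<open>V\<close> and passes
  to the smaller filtration of the normalized process by the tower property.  Convergence is Doob's
  theorem, by bounding the expected number of upcrossings.
\<close>

section \<open>The drift of the communication potential\<close>

text \<open>Cauchy--Schwarz for the vectors \<open>sqrt (p i)\<close> and
  \<open>sqrt (p i) * y i\<close>. The weights are left unnormalized because they will be a row of
  the array, whose total is the row sum.\<close>

lemma weighted_sum_squared_le:
  fixes p y :: "'a \<Rightarrow> real"
  assumes "\<And>i. i \<in> I \<Longrightarrow> p i \<ge> 0"
  shows "(\<Sum>i\<in>I. p i * y i)\<^sup>2 \<le> (\<Sum>i\<in>I. p i) * (\<Sum>i\<in>I. p i * (y i)\<^sup>2)"
proof -
  have "(\<Sum>i\<in>I. p i * y i) = (\<Sum>i\<in>I. sqrt (p i) * (sqrt (p i) * y i))"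
    by (rule sum.cong) (use assms in \<open>auto simp flip: mult.assoc\<close>)
  moreover have "(\<Sum>i\<in>I. p i) = (\<Sum>i\<in>I. (sqrt (p i))\<^sup>2)"
    by (rule sum.cong) (use assms in auto)
  moreover have "(\<Sum>i\<in>I. p i * (y i)\<^sup>2) = (\<Sum>i\<in>I. (sqrt (p i) * y i)\<^sup>2)"
    by (rule sum.cong) (use assms in \<open>auto simp: power_mult_distrib\<close>)
  ultimately show ?thesis
    using Cauchy_Schwarz_ineq_sum[of "\<lambda>i. sqrt (p i)" "\<lambda>i. sqrt (p i) * y i" I] by simp
qed

text \<open>The probability (entry over row sum) that Sender answers state \<open>i\<close> with
  signal \<open>j\<close>, times the probability (entry over column sum) that Receiver answers
  \<open>j\<close> with \<open>i\<close>. It is both a summand of the potential and, up to the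
  factor \<open>1 / M1\<close>, the probability of reinforcing \<open>(i, j)\<close>.\<close>

definition share :: "'a set \<Rightarrow> 'b set \<Rightarrow> ('a \<Rightarrow> 'b \<Rightarrow> real) \<Rightarrow> 'a \<Rightarrow> 'b \<Rightarrow> real" where
  "share I J v i j = (v i j)\<^sup>2 / ((\<Sum>l\<in>J. v i l) * (\<Sum>k\<in>I. v k j))"

definition potential :: "'a set \<Rightarrow> 'b set \<Rightarrow> ('a \<Rightarrow> 'b \<Rightarrow> real) \<Rightarrow> real" where
  "potential I J v = (\<Sum>i\<in>I. \<Sum>j\<in>J. share I J v i j)"

definition reinforce :: "'a \<Rightarrow> 'b \<Rightarrow> ('a \<Rightarrow> 'b \<Rightarrow> real) \<Rightarrow> 'a \<Rightarrow> 'b \<Rightarrow> real" where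
  "reinforce i j v = v(i := (v i)(j := v i j + 1))"

text \<open>The process constrains \<open>V\<close> only on \<open>S1 \<times> S2\<close>, so the
  updated array and its \<open>reinforce\<close> form may differ elsewhere; this transfers the
  potential between them.\<close>

lemma potential_cong:
  assumes "\<And>i j. i \<in> I \<Longrightarrow> j \<in> J \<Longrightarrow> v i j = v' i j"
  shows "potential I J v = potential I J v'"
  using assms by (simp add: potential_def share_def)

section \<open>Positive arrays and the effect of one reinforcement on their potential\<close>

locale positive_array =
  fixes I :: "'a set" and J :: "'b set" and v :: "'a \<Rightarrow> 'b \<Rightarrow> real"
  assumes finite_I: "finite I" and finite_J: "finite J"
    and pos: "\<And>i j. i \<in> I \<Longrightarrow> j \<in> J \<Longrightarrow> v i j > 0"
begin

abbreviation "R i \<equiv> \<Sum>l\<in>J. v i l"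
abbreviation "C j \<equiv> \<Sum>k\<in>I. v k j"
abbreviation "a \<equiv> share I J v"

lemma row_pos: "i \<in> I \<Longrightarrow> j \<in> J \<Longrightarrow> R i > 0"
  using finite_J pos by (intro sum_pos) auto

lemma col_pos: "i \<in> I \<Longrightarrow> j \<in> J \<Longrightarrow> C j > 0"
  using finite_I pos by (intro sum_pos) auto

lemma row_ge: "i \<in> I \<Longrightarrow> j \<in> J \<Longrightarrow> v i j \<le> R i"
  using finite_J pos by (intro member_le_sum) (auto intro: less_imp_le)

lemma col_ge: "i \<in> I \<Longrightarrow> j \<in> J \<Longrightarrow> v i j \<le> C j"
  using finite_I pos member_le_sum[of i I "\<lambda>i. v i j"] by (auto intro: less_imp_le)

lemma share_nonneg: "i \<in> I \<Longrightarrow> j \<in> J \<Longrightarrow> a i j \<ge> 0"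
  using row_pos[of i j] col_pos[of i j] by (simp add: share_def)

text \<open>Row sum and column sum both dominate the entry.\<close>

lemma share_le_1: "i \<in> I \<Longrightarrow> j \<in> J \<Longrightarrow> a i j \<le> 1"
proof -
  assume ij: "i \<in> I" "j \<in> J"
  have "v i j * v i j \<le> R i * C j"
    using row_ge[OF ij] col_ge[OF ij] pos[OF ij] row_pos[OF ij] by (intro mult_mono) auto
  then show ?thesis
    using row_pos[OF ij] col_pos[OF ij] by (simp only: share_def power2_eq_square) simp
qed

lemma potential_nonneg: "potential I J v \<ge> 0"
  unfolding potential_def by (intro sum_nonneg share_nonneg)

lemma potential_le: "potential I J v \<le> real (card I * card J)"
proof -
  have "potential I J v \<le> (\<Sum>i\<in>I. \<Sum>j\<in>J. 1)"
    unfolding potential_def by (intro sum_mono share_le_1)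
  then show ?thesis by simp
qed

lemma positive_array_reinforce: "positive_array I J (reinforce i j v)"
  using finite_I finite_J pos
  by unfold_locales (auto simp: reinforce_def add_pos_pos)

text \<open>Only row \<open>i\<close> and column \<open>j\<close> change. Old summands there shrink
  by the factor \<open>R i / (R i + 1)\<close> or \<open>C j / (C j + 1)\<close>, which gives the
  two subtracted sums. The crossing entry \<open>(i, j)\<close> occurs in both of them, whence the
  correction \<open>a i j\<close> in the first numerator; \<open>2 * v i j + 1\<close> is the growth
  of the square.\<close>

lemma potential_reinforce:
  assumes i: "i \<in> I" and j: "j \<in> J"
  shows "potential I J (reinforce i j v) - potential I J v =
    (2 * v i j + 1 + a i j) / ((R i + 1) * (C j + 1))
    - (\<Sum>l\<in>J. a i l) / (R i + 1) - (\<Sum>k\<in>I. a k j) / (C j + 1)"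
proof -
  let ?c = "(2 * v i j + 1 + a i j) / ((R i + 1) * (C j + 1))"
  have row: "(\<Sum>l\<in>J. reinforce i j v k l) = R k + (if k = i then 1 else 0)" for k
  proof -
    have "(\<Sum>l\<in>J. reinforce i j v k l) = (\<Sum>l\<in>J. v k l + (if l = j then if k = i then 1 else 0 else 0))"
      by (intro sum.cong) (auto simp: reinforce_def)
    then show ?thesis using j finite_J by (simp add: sum.distrib)
  qed
  have col: "(\<Sum>k\<in>I. reinforce i j v k l) = C l + (if l = j then 1 else 0)" for l
  proof -
    have "(\<Sum>k\<in>I. reinforce i j v k l) = (\<Sum>k\<in>I. v k l + (if k = i then if l = j then 1 else 0 else 0))"
      by (intro sum.cong) (auto simp: reinforce_def)
    then show ?thesis using i finite_I by (simp add: sum.distrib)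
  qed
  \<comment> \<open>One formula covers all positions of \<open>(k, l)\<close>. The conditionals are
    nested so that the sums over \<open>k\<close> and \<open>l\<close> collapse separately.\<close>
  have term_diff: "share I J (reinforce i j v) k l - a k l =
      (if k = i then if l = j then ?c else 0 else 0)
      - (if k = i then a k l / (R i + 1) else 0) - (if l = j then a k l / (C j + 1) else 0)"
    if k: "k \<in> I" and l: "l \<in> J" for k l
  proof -
    note p = row_pos[OF k l] col_pos[OF k l]
    have 1: "x\<^sup>2 / ((r + 1) * c) - x\<^sup>2 / (r * c) = - (x\<^sup>2 / (r * c) / (r + 1))"
      "x\<^sup>2 / (c * (r + 1)) - x\<^sup>2 / (c * r) = - (x\<^sup>2 / (c * r) / (r + 1))"
      if "r > 0" "c > 0" for x r c :: real
      using that by (simp_all add: divide_simps add_pos_pos) (simp_all add: algebra_simps)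
    have 2: "(x + 1)\<^sup>2 / ((r + 1) * (c + 1)) - x\<^sup>2 / (r * c) =
        (2 * x + 1 + x\<^sup>2 / (r * c)) / ((r + 1) * (c + 1))
        - x\<^sup>2 / (r * c) / (r + 1) - x\<^sup>2 / (r * c) / (c + 1)"
      if "r > 0" "c > 0" for x r c :: real
    proof -
      \<comment> \<open>The relations \<open>r * u = 1 - u\<close> and \<open>c * w = 1 - w\<close>
        eliminate \<open>r\<close> and \<open>c\<close> and leave a polynomial identity in
        \<open>x\<close>, \<open>q\<close>, \<open>u\<close> and \<open>w\<close>.\<close>
      define u where "u = 1 / (r + 1)"
      define w where "w = 1 / (c + 1)"
      define q where "q = x\<^sup>2 / (r * c)"
      have r: "r * u = 1 - u" and c: "c * w = 1 - w"
        using that by (simp_all add: u_def w_def divide_simps)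
      have x: "x\<^sup>2 = q * r * c" using that by (simp add: q_def)
      have "(x + 1)\<^sup>2 * (u * w) - q = q * (r * u) * (c * w) + (2 * x + 1) * (u * w) - q"
        by (simp add: power2_sum x algebra_simps)
      also have "\<dots> = (2 * x + 1 + q) * (u * w) - q * u - q * w"
        unfolding r c by (simp add: algebra_simps)
      finally show ?thesis
        by (simp add: u_def w_def q_def)
    qed
    show ?thesis
      using 1[OF p, of "v k l"] 1[OF p(2,1), of "v k l"] 2[OF p, of "v k l"]
      unfolding share_def row col by (auto simp: reinforce_def)
  qed
  have "potential I J (reinforce i j v) - potential I J v =
      (\<Sum>k\<in>I. \<Sum>l\<in>J. share I J (reinforce i j v) k l - a k l)"
    by (simp add: potential_def sum_subtractf)
  also have "\<dots> = (\<Sum>k\<in>I. \<Sum>l\<in>J. (if k = i then if l = j then ?c else 0 else 0)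
      - (if k = i then a k l / (R i + 1) else 0) - (if l = j then a k l / (C j + 1) else 0))"
    using term_diff by (intro sum.cong refl) auto
  also have "\<dots> = (\<Sum>k\<in>I. if k = i then \<Sum>l\<in>J. if l = j then ?c else 0 else 0)
      - (\<Sum>k\<in>I. if k = i then \<Sum>l\<in>J. a k l / (R i + 1) else 0) 
      - (\<Sum>k\<in>I. \<Sum>l\<in>J. if l = j then a k l / (C j + 1) else 0)"
    unfolding sum_subtractf by (intro arg_cong2[where f = "(-)"] sum.cong) auto
  also have "\<dots> = ?c - (\<Sum>l\<in>J. a i l) / (R i + 1) - (\<Sum>k\<in>I. a k j) / (C j + 1)"
    using i j finite_I finite_J by (simp add: sum_divide_distrib)
  finally show ?thesis .
qed

text \<open>Cauchy--Schwarz with the weights \<open>v i j\<close>, of total \<open>R i\<close>, and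
  the values \<open>v i j / (R i * C j)\<close>: the products are the shares, and the total
  \<open>R i\<close> cancels one factor of the denominator.\<close>

lemma row_share_squared_le:
  assumes i: "i \<in> I"
  shows "(\<Sum>j\<in>J. a i j)\<^sup>2 \<le> (\<Sum>j\<in>J. a i j * v i j / C j)"
proof (cases "J = {}")
  case False
  then have R: "R i > 0" using row_pos i by blast
  have "(\<Sum>j\<in>J. a i j)\<^sup>2 = (\<Sum>j\<in>J. v i j * (v i j / (R i * C j)))\<^sup>2"
    by (simp add: share_def power2_eq_square)
  also have "\<dots> \<le> R i * (\<Sum>j\<in>J. v i j * (v i j / (R i * C j))\<^sup>2)"
    using pos i by (intro weighted_sum_squared_le) (auto intro: less_imp_le)
  also have "\<dots> = (\<Sum>j\<in>J. a i j * v i j / C j)"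
  proof -
    have "r * (x * (x / (r * c))\<^sup>2) = x\<^sup>2 / (r * c) * x / c" if "r > 0" for r x c :: real
      using that by (simp add: power2_eq_square mult_ac)
    from this[OF R] show ?thesis
      unfolding share_def by (subst sum_distrib_left) (rule sum.cong[OF refl])
  qed
  finally show ?thesis .
qed auto

end

lemma share_transpose: "share J I (\<lambda>j i. v i j) j i = share I J v i j"
  by (simp add: share_def mult.commute)

text \<open>The row estimate for the transposed array, which has the same shares.\<close>

lemma (in positive_array) col_share_squared_le:
  assumes j: "j \<in> J"
  shows "(\<Sum>i\<in>I. a i j)\<^sup>2 \<le> (\<Sum>i\<in>I. a i j * v i j / R i)"
proof -
  interpret T: positive_array J I "\<lambda>j i. v i j"
    using finite_I finite_J pos by unfold_locales auto
  show ?thesis using T.row_share_squared_le[OF j] by (simp only: share_transpose[of J I v])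
qed

text \<open>After Cauchy--Schwarz the claim holds entrywise, as
  \<open>V/C + V/R \<le> 1 + (V/R) (V/C)\<close>, that is, \<open>(1 - V/R) (1 - V/C) \<ge> 0\<close>.\<close>

lemma (in positive_array) drift_nonneg:
  "(\<Sum>i\<in>I. \<Sum>j\<in>J. a i j * (potential I J (reinforce i j v) - potential I J v)) \<ge> 0"
proof -
  let ?g = "\<lambda>i j. a i j * ((2 * v i j + 1 + a i j) / ((R i + 1) * (C j + 1)))"
  have nn: "R i + 1 > 0" if "i \<in> I" for i
    using that pos by (intro add_nonneg_pos sum_nonneg) (auto intro: less_imp_le)
  have nn': "C j + 1 > 0" if "j \<in> J" for j
    using that pos by (intro add_nonneg_pos sum_nonneg) (auto intro: less_imp_le)
  have "(\<Sum>i\<in>I. (\<Sum>j\<in>J. a i j)\<^sup>2 / (R i + 1)) + (\<Sum>j\<in>J. (\<Sum>i\<in>I. a i j)\<^sup>2 / (C j + 1))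
    \<le> (\<Sum>i\<in>I. (\<Sum>j\<in>J. a i j * v i j / C j) / (R i + 1)) + (\<Sum>j\<in>J. (\<Sum>i\<in>I. a i j * v i j / R i) / (C j + 1))"
    by (intro add_mono sum_mono divide_right_mono row_share_squared_le col_share_squared_le)
      (auto intro: less_imp_le nn nn')
  also have "\<dots> = (\<Sum>i\<in>I. \<Sum>j\<in>J. a i j * v i j / C j / (R i + 1) + a i j * v i j / R i / (C j + 1))"
    by (simp add: sum_divide_distrib sum.distrib sum.swap[of _ J I])
  also have "\<dots> \<le> (\<Sum>i\<in>I. \<Sum>j\<in>J. ?g i j)"
  proof (intro sum_mono)
    fix i j assume ij: "i \<in> I" "j \<in> J"
    note p = row_pos[OF ij] col_pos[OF ij]
    \<comment> \<open>Since \<open>u / c * (c + 1) = u + u / c\<close>, the term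
      \<open>2 * u\<close> cancels and the product inequality for \<open>1 - u / r\<close> and
      \<open>1 - u / c\<close> remains.\<close>
    have le_abs: "u / c * (c + 1) + u / r * (r + 1) \<le> 2 * u + 1 + u\<^sup>2 / (r * c)"
      if "r > 0" "c > 0" "u \<le> r" "u \<le> c" for u r c :: real
    proof -
      have "(1 - u / r) * (1 - u / c) \<ge> 0" using that by simp
      then show ?thesis using that by (simp add: algebra_simps add_divide_distrib power2_eq_square)
    qed
    have split: "s * u / c / (r + 1) + s * u / r / (c + 1)
        = s * ((u / c * (c + 1) + u / r * (r + 1)) / ((r + 1) * (c + 1)))"
      if "r > 0" "c > 0" for s u r c :: real
    proof -
      have "r + 1 \<noteq> 0" "c + 1 \<noteq> 0" using that by auto
      then have "(u / c * (c + 1) + u / r * (r + 1)) / ((r + 1) * (c + 1)) = u / c / (r + 1) + u / r / (c + 1)"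
        by (rule add_frac_eq[symmetric])
      then show ?thesis by (simp only: distrib_left times_divide_eq_right)
    qed
    have le: "v i j / C j * (C j + 1) + v i j / R i * (R i + 1) \<le> 2 * v i j + 1 + a i j"
      unfolding share_def by (rule le_abs[OF p row_ge[OF ij] col_ge[OF ij]])
    have "a i j * v i j / C j / (R i + 1) + a i j * v i j / R i / (C j + 1)
        = a i j * ((v i j / C j * (C j + 1) + v i j / R i * (R i + 1)) / ((R i + 1) * (C j + 1)))"
      by (rule split[OF p])
    also have "\<dots> \<le> ?g i j"
      using le share_nonneg[OF ij] nn[OF ij(1)] nn'[OF ij(2)]
      by (intro mult_left_mono divide_right_mono) auto
    finally show "a i j * v i j / C j / (R i + 1) + a i j * v i j / R i / (C j + 1) \<le> ?g i j" .
  qed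
  finally have main: "(\<Sum>i\<in>I. (\<Sum>j\<in>J. a i j)\<^sup>2 / (R i + 1)) + (\<Sum>j\<in>J. (\<Sum>i\<in>I. a i j)\<^sup>2 / (C j + 1))
    \<le> (\<Sum>i\<in>I. \<Sum>j\<in>J. ?g i j)" .
  have "(\<Sum>i\<in>I. \<Sum>j\<in>J. a i j * (potential I J (reinforce i j v) - potential I J v)) =
    (\<Sum>i\<in>I. \<Sum>j\<in>J. ?g i j - a i j * ((\<Sum>l\<in>J. a i l) / (R i + 1)) - a i j * ((\<Sum>k\<in>I. a k j) / (C j + 1)))"
    by (intro sum.cong refl) (simp add: potential_reinforce right_diff_distrib)
  \<comment> \<open>The subtracted fractions depend on \<open>i\<close> alone or on \<open>j\<close>
    alone, so weighting them by \<open>a i j\<close> and summing produces squared row sums and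
    squared column sums of the shares.\<close>
  also have "\<dots> = (\<Sum>i\<in>I. \<Sum>j\<in>J. ?g i j) - (\<Sum>i\<in>I. (\<Sum>j\<in>J. a i j)\<^sup>2 / (R i + 1))
      - (\<Sum>j\<in>J. (\<Sum>i\<in>I. a i j)\<^sup>2 / (C j + 1))"
    unfolding sum_subtractf sum.swap[of "\<lambda>i j. a i j * ((\<Sum>k\<in>I. a k j) / (C j + 1))"]
    by (simp add: power2_eq_square flip: sum_distrib_right sum_divide_distrib)
  finally show ?thesis using main by linarith
qed

section \<open>Almost sure convergence of bounded submartingales\<close>

text \<open>The upcrossing strategy buys below \<open>a\<close> and sells above \<open>b\<close>.\<close>

primrec holding :: "real \<Rightarrow> real \<Rightarrow> (nat \<Rightarrow> real) \<Rightarrow> nat \<Rightarrow> bool" where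
  "holding a b x 0 = (x 0 < a)"
| "holding a b x (Suc n) = (if holding a b x n then x (Suc n) \<le> b else x (Suc n) < a)"

primrec upcrossings :: "real \<Rightarrow> real \<Rightarrow> (nat \<Rightarrow> real) \<Rightarrow> nat \<Rightarrow> nat" where
  "upcrossings a b x 0 = 0"
| "upcrossings a b x (Suc n) =
    upcrossings a b x n + (if holding a b x n \<and> x (Suc n) > b then 1 else 0)"

text \<open>A completed upcrossing earns at least \<open>b - a\<close>, and an open position, bought
  below \<open>a\<close>, has so far earned at least \<open>x n - a\<close>. Carrying the open
  position along makes the induction on \<open>n\<close> work.\<close>

lemma upcrossings_gain:
  assumes "a < b"
  shows "(b - a) * real (upcrossings a b x n) + (if holding a b x n then x n - a else 0)
    \<le> (\<Sum>k<n. if holding a b x k then x (Suc k) - x k else 0)"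
proof (induction n)
  case (Suc n)
  then show ?case using assms by (auto simp: algebra_simps split: if_splits)
qed auto

lemma upcrossings_mono: "mono (upcrossings a b x)"
  by (rule mono_iff_le_Suc[THEN iffD2]) auto

text \<open>A value below \<open>a\<close> leaves the strategy holding and a later value above
  \<open>b\<close> leaves it not holding, so a sale lies in between. Each such round adds an
  upcrossing.\<close>

lemma upcrossings_unbounded:
  assumes ab: "a < b" and low: "\<exists>\<^sub>F n in sequentially. x n < a" and high: "\<exists>\<^sub>F n in sequentially. x n > b"
  shows "\<exists>n. upcrossings a b x n \<ge> k"
proof (induction k)
  case (Suc k)
  then obtain n where n: "upcrossings a b x n \<ge> k" by blast
  have grow: "upcrossings a b x m \<ge> k" if "m \<ge> n" for m
    using n monoD[OF upcrossings_mono that, of a b x] by linarith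
  have "\<exists>m\<ge>n. holding a b x m"
  proof -
    obtain m where m: "m > n" "x m < a"
      using low unfolding frequently_sequentially by (meson Suc_le_lessD)
    obtain m' where "m = Suc m'" using m(1) by (cases m) auto
    then have "holding a b x m" using m ab by auto
    then show ?thesis using m by (intro exI[of _ m]) auto
  qed
  then obtain m where m: "m \<ge> n" "holding a b x m" by blast
  obtain r where r: "r > m" "x r > b"
    using high unfolding frequently_sequentially by (meson Suc_le_lessD)
  have "holding a b x r \<or> upcrossings a b x r \<ge> Suc k" if "r \<ge> m" for r
    using that
  proof (induction r rule: dec_induct)
    case (step r)
    have "upcrossings a b x r \<ge> k" using grow[of r] step m by simp
    then show ?case using step by auto
  qed (use m in auto)
  moreover have "\<not> holding a b x r" using r ab by (cases r) auto
  ultimately show ?case using r by (meson less_imp_le)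
qed auto

text \<open>If the lower limit were smaller than the upper one, two rationals would fit in between
  and the sequence would oscillate across them forever. Restricting to rationals keeps the family of
  exceptional null sets countable later.\<close>

lemma bounded_convergent_if_no_upcrossings:
  fixes x :: "nat \<Rightarrow> real"
  assumes bnd: "\<And>n. \<bar>x n\<bar> \<le> C"
    and no: "\<And>a b. a \<in> \<rat> \<Longrightarrow> b \<in> \<rat> \<Longrightarrow> a < b \<Longrightarrow>
      \<not> ((\<exists>\<^sub>F n in sequentially. x n < a) \<and> (\<exists>\<^sub>F n in sequentially. x n > b))"
  shows "convergent x"
proof -
  let ?x = "\<lambda>n. ereal (x n)"
  have "limsup ?x \<le> liminf ?x"
  proof (rule ccontr)
    assume "\<not> limsup ?x \<le> liminf ?x"
    then obtain a' where a': "liminf ?x < ereal a'" "ereal a' < limsup ?x"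
      using ereal_dense2[of "liminf ?x" "limsup ?x"] by (auto simp: not_le)
    then obtain b' where b': "ereal a' < ereal b'" "ereal b' < limsup ?x"
      using ereal_dense2[of a' "limsup ?x"] by auto
    \<comment> \<open>The point \<open>c\<close> separates the two rationals and so forces
      \<open>a < b\<close>.\<close>
    then obtain c where c: "a' < c" "c < b'" using dense[of a' b'] by auto
    obtain a where a: "a \<in> \<rat>" "a' < a" "a < c" using Rats_dense_in_real c by metis
    obtain b where b: "b \<in> \<rat>" "c < b" "b < b'" using Rats_dense_in_real c by metis
    have "liminf ?x < ereal a" "ereal b < limsup ?x"
      using a' a b b' by (meson less_ereal.simps(1) less_trans)+
    then have "\<exists>\<^sub>F n in sequentially. x n < a" "\<exists>\<^sub>F n in sequentially. x n > b"
      using Liminf_bounded[of "ereal a" ?x sequentially] Limsup_bounded[of ?x "ereal b" sequentially]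
      unfolding frequently_def by (auto simp: not_less)
    then show False using no[of a b] a b by auto
  qed
  then have eq: "liminf ?x = limsup ?x"
    by (simp add: Liminf_le_Limsup antisym)
  have lim: "?x \<longlonglongrightarrow> limsup ?x"
    using eq by (intro Liminf_eq_Limsup) auto
  have "- ereal C \<le> limsup ?x" "limsup ?x \<le> ereal C"
    using bnd lim by (auto intro!: LIMSEQ_le_const[OF lim] LIMSEQ_le_const2[OF lim] simp: abs_le_iff minus_le_iff)
  then obtain l where "limsup ?x = ereal l" by (cases "limsup ?x") auto
  then show ?thesis using lim unfolding convergent_def by auto
qed

section \<open>Doob's upcrossing estimate and convergence theorem\<close>

lemma (in prob_space) submartingale_increment_nonneg:
  assumes X: "submartingale M F X" and A: "A \<in> sets (F n)"
  shows "0 \<le> (\<integral>w. indicator A w * (X (Suc n) w - X n w) \<partial>M)"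
proof -
  have sub: "subalgebra M (F n)" and int: "\<And>n. integrable M (X n)"
    and le: "AE w in M. X n w \<le> real_cond_exp M (F n) (X (Suc n)) w"
    using X by (auto simp: submartingale_def)
  interpret finite_measure_subalgebra M "F n" using sub by unfold_locales
  have AM: "A \<in> sets M" using A sub by (auto simp: subalgebra_def)
  have i: "integrable M (\<lambda>w. indicator A w * X k w)" for k
    using integrable_mult_indicator[OF AM int, of k] by simp
  have i': "integrable M (\<lambda>w. indicator A w * real_cond_exp M (F n) (X (Suc n)) w)"
    using integrable_mult_indicator[OF AM real_cond_exp_int(1)[OF int[of "Suc n"]]] by simp
  \<comment> \<open>Integrate the conditional inequality over \<open>A\<close>; as \<open>A\<close>
    belongs to \<open>F n\<close>, the conditional expectation then integrates like
    \<open>X (Suc n)\<close>.\<close>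
  have "(\<integral>w. indicator A w * X n w \<partial>M) \<le> (\<integral>w. indicator A w * real_cond_exp M (F n) (X (Suc n)) w \<partial>M)"
    using le by (intro integral_mono_AE i i') (auto elim!: eventually_mono simp: indicator_def)
  also have "\<dots> = (\<integral>w. indicator A w * X (Suc n) w \<partial>M)"
    using A int by (intro real_cond_exp_intg i) auto
  finally show ?thesis
    using i by (simp add: right_diff_distrib)
qed

text \<open>The expected trading gain is bounded uniformly in time and dominates
  \<open>b - a\<close> times the expected number of upcrossings, up to a constant. By monotone
  convergence the total number of upcrossings has finite expectation.\<close>

lemma (in prob_space) bounded_submartingale_AE_finite_upcrossings:
  assumes X: "submartingale M F X" and C: "\<And>n w. w \<in> space M \<Longrightarrow> \<bar>X n w\<bar> \<le> C" and ab: "a < b"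
  shows "AE w in M. \<exists>K. \<forall>n. upcrossings a b (\<lambda>n. X n w) n \<le> K"
proof -
  have sub: "\<And>n. subalgebra M (F n)" and adapted: "\<And>n. X n \<in> borel_measurable (F n)"
    and int: "\<And>n. integrable M (X n)" and filt: "filtration (space M) F"
    using X by (auto simp: submartingale_def)
  have F_mono: "subalgebra (F n) (F k)" if "k \<le> n" for k n
    using filt that by (simp add: filtration_def subalgebra_def)
  have [measurable]: "X n \<in> borel_measurable M" for n using int by auto
  \<comment> \<open>Whether a position is held from time \<open>n\<close> to \<open>n + 1\<close> is
    decided by the values up to time \<open>n\<close>, so the strategy is predictable.\<close>
  have hold: "Measurable.pred (F n) (\<lambda>w. holding a b (\<lambda>n. X n w) n)" for n
  proof (induction n)
    case 0
    note [measurable] = adapted[of 0]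
    show ?case by simp
  next
    case (Suc n)
    note [measurable] = adapted[of "Suc n"]
    have [measurable]: "Measurable.pred (F (Suc n)) (\<lambda>w. holding a b (\<lambda>n. X n w) n)"
      by (rule measurable_from_subalg[OF F_mono Suc]) simp
    show ?case by simp
  qed
  have [measurable]: "Measurable.pred M (\<lambda>w. holding a b (\<lambda>n. X n w) n)" for n
    by (rule measurable_from_subalg[OF sub hold])
  define Hd where "Hd n = {w \<in> space M. holding a b (\<lambda>n. X n w) n}" for n
  have HdF: "Hd n \<in> sets (F n)" for n
    using hold[of n] sub[of n] by (simp add: Hd_def pred_def subalgebra_def)
  have [measurable]: "Hd n \<in> sets M" for n by (simp add: Hd_def)
  let ?U = "\<lambda>n w. upcrossings a b (\<lambda>n. X n w) n"
  have [measurable]: "?U n \<in> measurable M (count_space UNIV)" for n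
    by (induction n) simp_all
  have C0: "C \<ge> 0" using C not_empty by (metis abs_ge_zero ex_in_conv order_trans)
  have ibd: "integrable M (\<lambda>w. indicator (Hd k) w * (X (Suc k) w - X k w))" for k
    using integrable_mult_indicator[of "Hd k" M, OF _ Bochner_Integration.integrable_diff[OF int[of "Suc k"] int[of k]]] by simp
  have ibd': "integrable M (\<lambda>w. indicator (space M - Hd k) w * (X (Suc k) w - X k w))" for k
    using integrable_mult_indicator[of "space M - Hd k" M, OF _ Bochner_Integration.integrable_diff[OF int[of "Suc k"] int[of k]]] by simp
  \<comment> \<open>An open position is worth at least \<open>- (C + \<bar>a\<bar>)\<close>; if none
    is open, \<open>C \<ge> 0\<close> is enough.\<close>
  have le: "(b - a) * real (?U n w) \<le> C + \<bar>a\<bar> + (\<Sum>k<n. indicator (Hd k) w * (X (Suc k) w - X k w))"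
    if w: "w \<in> space M" for n w
  proof -
    have "(\<Sum>k<n. if holding a b (\<lambda>n. X n w) k then X (Suc k) w - X k w else 0)
      = (\<Sum>k<n. indicator (Hd k) w * (X (Suc k) w - X k w))"
      using w by (intro sum.cong) (auto simp: Hd_def)
    then show ?thesis
      using upcrossings_gain[OF ab, of "\<lambda>n. X n w" n] C[OF w, of n] C0
      by (auto split: if_splits)
  qed
  \<comment> \<open>The complementary strategy also has nonnegative expected gain, so holding only
    on \<open>Hd k\<close> earns in expectation at most what holding always earns, which is the
    expectation of \<open>X n - X 0\<close>.\<close>
  have gain: "(\<integral>w. (\<Sum>k<n. indicator (Hd k) w * (X (Suc k) w - X k w)) \<partial>M) \<le> 2 * C" for n
  proof -
    have "(\<integral>w. (\<Sum>k<n. indicator (Hd k) w * (X (Suc k) w - X k w)) \<partial>M)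
      = (\<Sum>k<n. \<integral>w. indicator (Hd k) w * (X (Suc k) w - X k w) \<partial>M)"
      using ibd by (rule Bochner_Integration.integral_sum)
    also have "\<dots> \<le> (\<Sum>k<n. \<integral>w. X (Suc k) w - X k w \<partial>M)"
    proof (rule sum_mono)
      fix k
      have "space M - Hd k \<in> sets (F k)"
        using HdF[of k] sub[of k] by (metis sets.compl_sets subalgebra_def)
      then have "0 \<le> (\<integral>w. indicator (space M - Hd k) w * (X (Suc k) w - X k w) \<partial>M)"
        by (rule submartingale_increment_nonneg[OF X])
      also have "(\<integral>w. indicator (Hd k) w * (X (Suc k) w - X k w) \<partial>M) + \<dots>
          = (\<integral>w. X (Suc k) w - X k w \<partial>M)"
        unfolding Bochner_Integration.integral_add[OF ibd ibd', symmetric]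
        by (intro Bochner_Integration.integral_cong) (auto simp: indicator_def)
      finally show "(\<integral>w. indicator (Hd k) w * (X (Suc k) w - X k w) \<partial>M)
          \<le> (\<integral>w. X (Suc k) w - X k w \<partial>M)" by simp
    qed
    also have "\<dots> = (\<Sum>k<n. (\<integral>w. X (Suc k) w \<partial>M) - (\<integral>w. X k w \<partial>M))"
      using int by simp
    also have "\<dots> = (\<integral>w. X n w \<partial>M) - (\<integral>w. X 0 w \<partial>M)"
      by (rule sum_lessThan_telescope)
    also have "\<dots> = (\<integral>w. X n w - X 0 w \<partial>M)"
      using int by simp
    also have "\<dots> \<le> (\<integral>w. 2 * C \<partial>M)"
    proof (intro integral_mono)
      fix w assume "w \<in> space M"
      then show "X n w - X 0 w \<le> 2 * C" using C[of w n] C[of w 0] by linarith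
    qed (use int in auto)
    finally show ?thesis by (simp add: prob_space)
  qed
  \<comment> \<open>Of \<open>3 * C + \<bar>a\<bar>\<close>, the expected gain contributes
    \<open>2 * C\<close> and the open position \<open>C + \<bar>a\<bar>\<close>.\<close>
  have U_int: "(\<integral>\<^sup>+w. ennreal (real (?U n w)) \<partial>M) \<le> ennreal ((3 * C + \<bar>a\<bar>) / (b - a))" for n
  proof -
    define Y where "Y w = (\<Sum>k<n. indicator (Hd k) w * (X (Suc k) w - X k w))" for w
    let ?g = "\<lambda>w. (C + \<bar>a\<bar> + Y w) / (b - a)"
    have ig: "integrable M Y"
      unfolding Y_def[abs_def] using ibd by (rule Bochner_Integration.integrable_sum)
    have gY: "(\<integral>w. Y w \<partial>M) \<le> 2 * C"
      unfolding Y_def by (rule gain)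
    have U_le: "real (?U n w) \<le> ?g w" if "w \<in> space M" for w
      using le[OF that, of n, folded Y_def] ab by (simp add: field_simps)
    have "(\<integral>\<^sup>+w. ennreal (real (?U n w)) \<partial>M) \<le> (\<integral>\<^sup>+w. ennreal (?g w) \<partial>M)"
      using U_le by (intro nn_integral_mono ennreal_leI)
    also have "\<dots> = ennreal (\<integral>w. ?g w \<partial>M)"
    proof (rule nn_integral_eq_integral)
      show "integrable M ?g" using ig by simp
      show "AE w in M. 0 \<le> ?g w"
        using U_le by (intro AE_I2) (meson of_nat_0_le_iff order_trans)
    qed
    also have "\<dots> \<le> ennreal ((3 * C + \<bar>a\<bar>) / (b - a))"
      using gY ig ab by (intro ennreal_leI) (simp add: prob_space divide_right_mono)
    finally show ?thesis .
  qed
  have "(\<integral>\<^sup>+w. (SUP n. ennreal (real (?U n w))) \<partial>M) = (SUP n. \<integral>\<^sup>+w. ennreal (real (?U n w)) \<partial>M)"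
    by (intro nn_integral_monotone_convergence_SUP)
      (auto simp: incseq_def le_fun_def intro!: ennreal_leI monoD[OF upcrossings_mono])
  also have "\<dots> \<le> ennreal ((3 * C + \<bar>a\<bar>) / (b - a))"
    using U_int by (rule SUP_least)
  finally have "(\<integral>\<^sup>+w. (SUP n. ennreal (real (?U n w))) \<partial>M) \<noteq> \<infinity>"
    by (auto simp: top_unique)
  then have "AE w in M. (SUP n. ennreal (real (?U n w))) \<noteq> \<infinity>"
    by (intro nn_integral_PInf_AE) auto
  then show ?thesis
  proof (rule eventually_mono)
    fix w assume "(SUP n. ennreal (real (?U n w))) \<noteq> \<infinity>"
    then obtain K where K: "(SUP n. ennreal (real (?U n w))) = ennreal K" "K \<ge> 0"
      by (cases "(SUP n. ennreal (real (?U n w)))") auto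
    have "?U n w \<le> nat \<lceil>K\<rceil>" for n
    proof -
      have "ennreal (real (?U n w)) \<le> ennreal K"
        unfolding K(1)[symmetric] by (rule SUP_upper) simp
      then have "real (?U n w) \<le> K" using K(2) by (simp add: ennreal_le_iff)
      then show ?thesis by linarith
    qed
    then show "\<exists>K. \<forall>n. ?U n w \<le> K" by blast
  qed
qed

text \<open>A single null set serves all rational pairs \<open>a < b\<close>; off it, infinite
  oscillation would contradict the bound on upcrossings.\<close>

lemma (in prob_space) bounded_submartingale_AE_convergent:
  assumes X: "submartingale M F X" and bnd: "bounded_process M X"
  shows "AE w in M. convergent (\<lambda>n. X n w)"
proof -
  obtain C where C: "\<And>n w. w \<in> space M \<Longrightarrow> \<bar>X n w\<bar> \<le> C"
    using bnd by (auto simp: bounded_process_def)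
  have "AE w in M. \<forall>a\<in>\<rat>. \<forall>b\<in>\<rat>. a < b \<longrightarrow> (\<exists>K. \<forall>n. upcrossings a b (\<lambda>n. X n w) n \<le> K)"
    using bounded_submartingale_AE_finite_upcrossings[OF X C]
    by (simp add: AE_ball_countable countable_rat)
  with AE_space show ?thesis
  proof eventually_elim
    case (elim w)
    show ?case
    proof (rule bounded_convergent_if_no_upcrossings)
      fix a b :: real assume "a \<in> \<rat>" "b \<in> \<rat>" "a < b"
      then obtain K where K: "\<And>n. upcrossings a b (\<lambda>n. X n w) n \<le> K" using elim by blast
      then show "\<not> ((\<exists>\<^sub>F n in sequentially. X n w < a) \<and> (\<exists>\<^sub>F n in sequentially. X n w > b))"
        using upcrossings_unbounded[OF \<open>a < b\<close>, of "\<lambda>n. X n w" "Suc K"] not_less_eq_eq by blast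
    qed (use C elim in auto)
  qed
qed

section \<open>Generated algebras\<close>

lemma array_history_in_space: "array_history I A X w \<in> space (array_history_space I A)"
  by (auto simp: array_history_def array_history_space_def space_PiM PiE_def)

lemma space_array_history_algebra [simp]: "space (array_history_algebra M I A X) = space M"
  by (simp add: array_history_algebra_def)

lemma measurable_array_history:
  assumes "\<And>m i j. m \<in> I \<Longrightarrow> (i, j) \<in> A \<Longrightarrow> (\<lambda>w. X m w i j) \<in> borel_measurable N"
  shows "array_history I A X \<in> N \<rightarrow>\<^sub>M array_history_space I A"
  unfolding array_history_def array_history_space_def
  using assms by (intro measurable_restrict) auto

lemma measurable_array_history_entry:
  assumes "array_history I A X \<in> N \<rightarrow>\<^sub>M array_history_space I A" and m: "m \<in> I" and p: "(i, j) \<in> A"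
  shows "(\<lambda>w. X m w i j) \<in> borel_measurable N"
proof -
  have "(\<lambda>h. h m (i, j)) \<in> array_history_space I A \<rightarrow>\<^sub>M borel"
    unfolding array_history_space_def
    by (rule measurable_compose[OF measurable_component_singleton[OF m] measurable_component_singleton[OF p]])
  from measurable_compose[OF assms(1) this] show ?thesis
    using m p by (simp add: array_history_def)
qed

lemma measurable_array_history_algebra:
  assumes "m \<in> I" "(i, j) \<in> A"
  shows "(\<lambda>w. X m w i j) \<in> borel_measurable (array_history_algebra M I A X)"
  using assms unfolding array_history_algebra_def
  by (intro measurable_array_history_entry[of I A X] measurable_vimage_algebra1)
    (auto simp: array_history_in_space)

lemma subalgebra_vimage:
  assumes "Z \<in> M \<rightarrow>\<^sub>M N"
  shows "subalgebra M (vimage_algebra (space M) Z N)"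
  using assms by (simp add: subalgebra_def sets_image_in_sets)

text \<open>The algebra of a history is the smallest one making its entries measurable, so comparing
  histories reduces to comparing single entries.\<close>

lemma subalgebra_array_history_algebra:
  assumes "space N = space M"
    and "\<And>m i j. m \<in> I \<Longrightarrow> (i, j) \<in> A \<Longrightarrow> (\<lambda>w. X m w i j) \<in> borel_measurable N"
  shows "subalgebra N (array_history_algebra M I A X)"
  using subalgebra_vimage[of "array_history I A X" N] measurable_array_history[of I A X N] assms
  by (simp add: array_history_algebra_def)

lemma pred_eq_count_space:
  assumes "f \<in> M \<rightarrow>\<^sub>M count_space S"
  shows "Measurable.pred M (\<lambda>w. f w = i)"
  using measurable_compose[OF assms, of "\<lambda>x. x = i"] by simp

section \<open>Integrals against conditional probabilities and conditional expectations\<close>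

lemma (in prob_space) integrable_if_bounded:
  fixes f :: "'a \<Rightarrow> real"
  assumes "f \<in> borel_measurable M" "\<And>w. w \<in> space M \<Longrightarrow> \<bar>f w\<bar> \<le> B"
  shows "integrable M f"
  using assms by (intro integrable_const_bound[of _ B]) auto

text \<open>Replaces an event by its conditional probability under the integral. The product is
  named \<open>h\<close> because \<open>f\<close> will contain indicators of a fixed state and
  signal: they turn \<open>q\<close>, stated at the random state or signal, into an expression at
  fixed \<open>i\<close> and \<open>j\<close>.\<close>

lemma (in prob_space) integral_indicator_cond_prob:
  fixes f :: "'a \<Rightarrow> real"
  assumes sub: "subalgebra M N" and f: "f \<in> borel_measurable N"
    and B: "\<And>w. w \<in> space M \<Longrightarrow> \<bar>f w\<bar> \<le> B"
    and E: "E \<in> sets M" and q: "AE w in M. real_cond_exp M N (indicator E) w = q w"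
    and h: "h \<in> borel_measurable M" "\<And>w. w \<in> space M \<Longrightarrow> f w * q w = h w"
  shows "(\<integral>w. f w * indicator E w \<partial>M) = (\<integral>w. h w \<partial>M)"
proof -
  interpret finite_measure_subalgebra M N using sub by unfold_locales
  have fM: "f \<in> borel_measurable M" using f sub measurable_from_subalg by blast
  have int: "integrable M (\<lambda>w. f w * indicator E w)"
  proof (rule integrable_if_bounded)
    show "(\<lambda>w. f w * indicator E w) \<in> borel_measurable M" using fM E by simp
    fix w assume "w \<in> space M"
    then show "\<bar>f w * indicator E w\<bar> \<le> B" using B[of w] by (auto simp: indicator_def)
  qed
  have "(\<integral>w. f w * indicator E w \<partial>M) = (\<integral>w. f w * real_cond_exp M N (indicator E) w \<partial>M)"
    using real_cond_exp_intg(2)[OF int f] E by simp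
  also have "\<dots> = (\<integral>w. h w \<partial>M)"
  proof (rule integral_cong_AE)
    show "AE w in M. f w * real_cond_exp M N (indicator E) w = h w"
      using q AE_space by eventually_elim (use h in auto)
  qed (use fM h in auto)
  finally show ?thesis .
qed

text \<open>This is the tower property: \<open>D\<close> will be the drift, which is computed from a
  larger past than \<open>N\<close>. Equal integrals over the sets of \<open>N\<close> give equal
  conditional expectations, and that of \<open>D\<close> is nonnegative.\<close>

lemma (in prob_space) cond_exp_increment_nonneg:
  assumes sub: "subalgebra M N" and X: "X \<in> borel_measurable N" "integrable M X"
    and Y: "integrable M Y" and D: "integrable M D" "AE w in M. D w \<ge> 0"
    and eq: "\<And>A. A \<in> sets N \<Longrightarrow> (\<integral>w. indicator A w * (Y w - X w) \<partial>M) = (\<integral>w. indicator A w * D w \<partial>M)"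
  shows "AE w in M. X w \<le> real_cond_exp M N Y w"
proof -
  interpret finite_measure_subalgebra M N using sub by unfold_locales
  have "AE w in M. real_cond_exp M N (\<lambda>w. Y w - X w) w = real_cond_exp M N D w"
  proof (rule real_cond_exp_charact)
    fix A assume A: "A \<in> sets N"
    have "(\<integral>w\<in>A. (Y w - X w) \<partial>M) = (\<integral>w\<in>A. D w \<partial>M)"
      using eq[OF A] by (simp add: set_lebesgue_integral_def)
    then show "(\<integral>w\<in>A. (Y w - X w) \<partial>M) = (\<integral>w\<in>A. real_cond_exp M N D w \<partial>M)"
      using real_cond_exp_intA[OF D(1) A] by simp
  qed (use X Y D in auto)
  moreover have "AE w in M. real_cond_exp M N (\<lambda>w. Y w - X w) w
      = real_cond_exp M N Y w - real_cond_exp M N X w"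
    using X Y by simp
  moreover have "AE w in M. real_cond_exp M N X w = X w"
    using X by simp
  moreover have "AE w in M. real_cond_exp M N D w \<ge> 0"
    using D by (intro real_cond_exp_pos) auto
  ultimately show ?thesis by eventually_elim linarith
qed

section \<open>The signaling process\<close>

context signaling_process
begin

abbreviation past :: "nat \<Rightarrow> 'w measure" where
  "past n \<equiv> array_history_algebra M {..n} (S1 \<times> S2) V"

abbreviation past_st :: "nat \<Rightarrow> 'w measure" where
  "past_st n \<equiv> vimage_algebra (space M) (\<lambda>u. (array_history {..n} (S1 \<times> S2) V u, st n u))
     (array_history_space {..n} (S1 \<times> S2) \<Otimes>\<^sub>M count_space S1)"

abbreviation past_st_sg :: "nat \<Rightarrow> 'w measure" where
  "past_st_sg n \<equiv> vimage_algebra (space M) (\<lambda>u. (array_history {..n} (S1 \<times> S2) V u, st n u, sg n u))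
     (array_history_space {..n} (S1 \<times> S2) \<Otimes>\<^sub>M count_space S1 \<Otimes>\<^sub>M count_space S2)"

section \<open>Positivity and measurability of the weights, and the algebras of the past\<close>

lemma S1_nonempty: "S1 \<noteq> {}" and S2_nonempty: "S2 \<noteq> {}"
  using M1_pos M2_pos card_S1 card_S2 by auto

lemma st_in: "w \<in> space M \<Longrightarrow> st n w \<in> S1" and sg_in: "w \<in> space M \<Longrightarrow> sg n w \<in> S2"
  using measurable_space[OF state_measurable] measurable_space[OF signal_measurable] by auto

lemma V_ge_1: "w \<in> space M \<Longrightarrow> i \<in> S1 \<Longrightarrow> j \<in> S2 \<Longrightarrow> V n w i j \<ge> 1"
proof (induction n)
  case 0
  then show ?case by (simp add: V_init)
next
  case (Suc n)
  then show ?case by (auto simp: V_step intro: add_increasing2)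
qed

lemma positive_array_V: "w \<in> space M \<Longrightarrow> positive_array S1 S2 (V n w)"
  using V_ge_1 finite_S1 finite_S2 by unfold_locales (auto intro: less_le_trans[OF zero_less_one])

lemma measurable_V: "i \<in> S1 \<Longrightarrow> j \<in> S2 \<Longrightarrow> (\<lambda>w. V n w i j) \<in> borel_measurable M"
proof (induction n)
  case 0
  then show ?case using V_init by (subst measurable_cong[where g = "\<lambda>_. 1"]) auto
next
  case (Suc n)
  note [measurable] = pred_eq_count_space[OF state_measurable] pred_eq_count_space[OF signal_measurable]
    pred_eq_count_space[OF act_measurable] Suc.IH[OF Suc.prems]
  \<comment> \<open>Comparing the draws with the fixed \<open>i\<close> and \<open>j\<close> turns
    the condition into a conjunction of measurable events.\<close>
  have "V (Suc n) w i j = (if act n w = i \<and> st n w = i \<and> sg n w = j then V n w i j + 1 else V n w i j)"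
    if "w \<in> space M" for w
    using V_step[OF that Suc.prems, of n] by auto
  then show ?case
    by (subst measurable_cong) auto
qed

lemma subalgebra_past: "subalgebra M (past n)"
  using measurable_V by (intro subalgebra_array_history_algebra) auto

lemma measurable_V_past: "i \<in> S1 \<Longrightarrow> j \<in> S2 \<Longrightarrow> m \<le> n \<Longrightarrow> (\<lambda>w. V m w i j) \<in> borel_measurable (past n)"
  by (rule measurable_array_history_algebra) auto

lemma measurable_history: "array_history {..n} (S1 \<times> S2) V \<in> M \<rightarrow>\<^sub>M array_history_space {..n} (S1 \<times> S2)"
  using measurable_V by (intro measurable_array_history) auto

lemma subalgebra_past_st: "subalgebra M (past_st n)"
  by (intro subalgebra_vimage measurable_Pair measurable_history state_measurable)

lemma subalgebra_past_st_sg: "subalgebra M (past_st_sg n)"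
  by (intro subalgebra_vimage measurable_Pair measurable_history state_measurable signal_measurable)

lemma past_st_projections:
  "array_history {..n} (S1 \<times> S2) V \<in> past_st n \<rightarrow>\<^sub>M array_history_space {..n} (S1 \<times> S2)"
  "st n \<in> past_st n \<rightarrow>\<^sub>M count_space S1"
proof -
  have Z: "(\<lambda>u. (array_history {..n} (S1 \<times> S2) V u, st n u))
      \<in> past_st n \<rightarrow>\<^sub>M array_history_space {..n} (S1 \<times> S2) \<Otimes>\<^sub>M count_space S1"
    by (rule measurable_vimage_algebra1) (auto simp: array_history_in_space st_in space_pair_measure)
  show "array_history {..n} (S1 \<times> S2) V \<in> past_st n \<rightarrow>\<^sub>M array_history_space {..n} (S1 \<times> S2)"
    "st n \<in> past_st n \<rightarrow>\<^sub>M count_space S1"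
    using measurable_compose[OF Z measurable_fst] measurable_compose[OF Z measurable_snd] by auto
qed

lemma past_st_sg_projections:
  "array_history {..n} (S1 \<times> S2) V \<in> past_st_sg n \<rightarrow>\<^sub>M array_history_space {..n} (S1 \<times> S2)"
  "st n \<in> past_st_sg n \<rightarrow>\<^sub>M count_space S1"
  "sg n \<in> past_st_sg n \<rightarrow>\<^sub>M count_space S2"
proof -
  have Z: "(\<lambda>u. (array_history {..n} (S1 \<times> S2) V u, st n u, sg n u))
      \<in> past_st_sg n \<rightarrow>\<^sub>M array_history_space {..n} (S1 \<times> S2) \<Otimes>\<^sub>M count_space S1 \<Otimes>\<^sub>M count_space S2"
    by (rule measurable_vimage_algebra1) (auto simp: array_history_in_space st_in sg_in space_pair_measure)
  note Z2 = measurable_compose[OF Z measurable_snd]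
  show "array_history {..n} (S1 \<times> S2) V \<in> past_st_sg n \<rightarrow>\<^sub>M array_history_space {..n} (S1 \<times> S2)"
    "st n \<in> past_st_sg n \<rightarrow>\<^sub>M count_space S1" "sg n \<in> past_st_sg n \<rightarrow>\<^sub>M count_space S2"
    using measurable_compose[OF Z measurable_fst] measurable_compose[OF Z2 measurable_fst]
      measurable_compose[OF Z2 measurable_snd] by auto
qed

lemma past_le_past_st: "subalgebra (past_st n) (past n)"
  by (rule subalgebra_array_history_algebra)
    (auto intro: measurable_array_history_entry[OF past_st_projections(1)])

lemma past_le_past_st_sg: "subalgebra (past_st_sg n) (past n)"
  by (rule subalgebra_array_history_algebra)
    (auto intro: measurable_array_history_entry[OF past_st_sg_projections(1)])

text \<open>The three draws are integrated out in reverse order: the act contributes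
  \<open>\<psi>\<close>, the signal \<open>\<phi>\<close> and the state \<open>1 / real M1\<close>.
  The product of \<open>\<psi>\<close> and \<open>\<phi>\<close> is the share.\<close>

lemma integral_reinforced:
  assumes i: "i \<in> S1" and j: "j \<in> S2" and f: "f \<in> borel_measurable (past n)"
    and B: "\<And>w. w \<in> space M \<Longrightarrow> \<bar>f w\<bar> \<le> B"
  shows "(\<integral>w. f w * indicator {w \<in> space M. st n w = i \<and> sg n w = j \<and> act n w = i} w \<partial>M)
    = (\<integral>w. f w * (share S1 S2 (V n w) i j / real M1) \<partial>M)"
proof -
  define \<phi> where "\<phi> w = V n w i j / (\<Sum>l\<in>S2. V n w i l)" for w
  define \<psi> where "\<psi> w = V n w i j / (\<Sum>k\<in>S1. V n w k j)" for w
  have frac: "\<bar>\<phi> w\<bar> \<le> 1" "\<bar>\<psi> w\<bar> \<le> 1" if "w \<in> space M" for w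
  proof -
    interpret positive_array S1 S2 "V n w" using that by (rule positive_array_V)
    show "\<bar>\<phi> w\<bar> \<le> 1" "\<bar>\<psi> w\<bar> \<le> 1"
      unfolding \<phi>_def \<psi>_def
      using pos[OF i j] row_pos[OF i j] col_pos[OF i j] row_ge[OF i j] col_ge[OF i j] by auto
  qed
  have \<phi>: "\<phi> \<in> borel_measurable (past n)" and \<psi>: "\<psi> \<in> borel_measurable (past n)"
    unfolding \<phi>_def \<psi>_def using i j
    by (auto intro!: borel_measurable_divide borel_measurable_sum measurable_V_past)
  note up = measurable_from_subalg
  note [measurable] = pred_eq_count_space[OF state_measurable] pred_eq_count_space[OF signal_measurable]
    pred_eq_count_space[OF act_measurable] up[OF subalgebra_past f] up[OF subalgebra_past \<phi>]
    up[OF subalgebra_past \<psi>]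
  have bound1: "\<bar>f w * \<psi> w\<bar> \<le> B" if "w \<in> space M" for w
    using mult_mono[OF B[OF that] frac(2)[OF that]] B[OF that] by (simp add: abs_mult)
  have bound2: "\<bar>f w * \<psi> w * \<phi> w\<bar> \<le> B" if "w \<in> space M" for w
    using mult_mono[OF bound1[OF that] frac(1)[OF that]] order_trans[OF abs_ge_zero bound1[OF that]]
    by (simp add: abs_mult)
  have "(\<integral>w. f w * indicator {w \<in> space M. st n w = i \<and> sg n w = j \<and> act n w = i} w \<partial>M)
      = (\<integral>w. (f w * of_bool (st n w = i \<and> sg n w = j)) * indicator {w \<in> space M. act n w = i} w \<partial>M)"
    by (intro Bochner_Integration.integral_cong) (auto simp: indicator_def)
  also have "\<dots> = (\<integral>w. f w * \<psi> w * of_bool (st n w = i \<and> sg n w = j) \<partial>M)"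
  \<comment> \<open>The current state and signal belong to the past of the act, so their indicators
    may stand in the measurable factor, where they fix the signal in \<open>act_law\<close> to
    \<open>j\<close>.\<close>
  proof (rule integral_indicator_cond_prob[OF subalgebra_past_st_sg _ _ _ act_law[OF i]])
    note [measurable] = pred_eq_count_space[OF past_st_sg_projections(2)]
      pred_eq_count_space[OF past_st_sg_projections(3)] up[OF past_le_past_st_sg f]
    show "(\<lambda>w. f w * of_bool (st n w = i \<and> sg n w = j)) \<in> borel_measurable (past_st_sg n)"
      by measurable
    show "\<bar>f w * of_bool (st n w = i \<and> sg n w = j)\<bar> \<le> B" if "w \<in> space M" for w
      using B[OF that] by auto
    show "(\<lambda>w. f w * \<psi> w * of_bool (st n w = i \<and> sg n w = j)) \<in> borel_measurable M"
      by measurable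
  qed (auto simp: \<psi>_def)
  also have "\<dots> = (\<integral>w. (f w * \<psi> w * of_bool (st n w = i)) * indicator {w \<in> space M. sg n w = j} w \<partial>M)"
    by (intro Bochner_Integration.integral_cong) (auto simp: indicator_def)
  also have "\<dots> = (\<integral>w. f w * \<psi> w * \<phi> w * of_bool (st n w = i) \<partial>M)"
  proof (rule integral_indicator_cond_prob[OF subalgebra_past_st _ _ _ signal_law[OF j]])
    note [measurable] = pred_eq_count_space[OF past_st_projections(2)]
      up[OF past_le_past_st f] up[OF past_le_past_st \<psi>]
    show "(\<lambda>w. f w * \<psi> w * of_bool (st n w = i)) \<in> borel_measurable (past_st n)"
      by measurable
    show "\<bar>f w * \<psi> w * of_bool (st n w = i)\<bar> \<le> B" if "w \<in> space M" for w
      using bound1[OF that] by auto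
    show "(\<lambda>w. f w * \<psi> w * \<phi> w * of_bool (st n w = i)) \<in> borel_measurable M"
      by measurable
  qed (auto simp: \<phi>_def)
  also have "\<dots> = (\<integral>w. (f w * \<psi> w * \<phi> w) * indicator {w \<in> space M. st n w = i} w \<partial>M)"
    by (intro Bochner_Integration.integral_cong) (auto simp: indicator_def)
  also have "\<dots> = (\<integral>w. f w * \<psi> w * \<phi> w * (1 / real M1) \<partial>M)"
    using f \<phi> \<psi> bound2 by (intro integral_indicator_cond_prob[OF subalgebra_past _ _ _ state_law[OF i]]) auto
  also have "\<dots> = (\<integral>w. f w * (share S1 S2 (V n w) i j / real M1) \<partial>M)"
    by (intro Bochner_Integration.integral_cong)
      (auto simp: share_def \<phi>_def \<psi>_def power2_eq_square mult_ac)
  finally show ?thesis .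
qed

section \<open>Increment and drift of the potential along the process\<close>

lemma measurable_potential_past: "(\<lambda>w. potential S1 S2 (V n w)) \<in> borel_measurable (past n)"
  unfolding potential_def share_def
  by (intro borel_measurable_sum borel_measurable_divide borel_measurable_times borel_measurable_power
      measurable_V_past) auto

lemma measurable_share_past:
  "i \<in> S1 \<Longrightarrow> j \<in> S2 \<Longrightarrow> (\<lambda>w. share S1 S2 (V n w) i j) \<in> borel_measurable (past n)"
  unfolding share_def
  by (intro borel_measurable_sum borel_measurable_divide borel_measurable_times borel_measurable_power
      measurable_V_past) auto

lemma measurable_reinforce_past:
  assumes "i \<in> S1" "j \<in> S2" "k \<in> S1" "l \<in> S2"
  shows "(\<lambda>w. reinforce i j (V n w) k l) \<in> borel_measurable (past n)"
proof -
  note [measurable] = measurable_V_past[OF assms(1,2) order.refl] measurable_V_past[OF assms(3,4) order.refl]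
  have "(\<lambda>w. reinforce i j (V n w) k l)
      = (\<lambda>w. if k = i \<and> l = j then V n w i j + 1 else V n w k l)"
    by (auto simp: reinforce_def)
  then show ?thesis by simp
qed

lemma measurable_potential_reinforce_past:
  "i \<in> S1 \<Longrightarrow> j \<in> S2 \<Longrightarrow> (\<lambda>w. potential S1 S2 (reinforce i j (V n w))) \<in> borel_measurable (past n)"
  unfolding potential_def share_def
  by (intro borel_measurable_sum borel_measurable_divide borel_measurable_times borel_measurable_power
      measurable_reinforce_past) auto

text \<open>The hypothetical change if \<open>(i, j)\<close> were reinforced. It depends on
  \<open>V n\<close> only, so the new randomness of the step lies entirely in which entry is
  reinforced.\<close>

definition increment :: "nat \<Rightarrow> 's \<Rightarrow> 's \<Rightarrow> 'w \<Rightarrow> real" where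
  "increment n i j w = potential S1 S2 (reinforce i j (V n w)) - potential S1 S2 (V n w)"

text \<open>The conditional expectation of the change of the potential given
  \<open>past n\<close>.\<close>

definition drift :: "nat \<Rightarrow> 'w \<Rightarrow> real" where
  "drift n w = (\<Sum>i\<in>S1. \<Sum>j\<in>S2. increment n i j w * (share S1 S2 (V n w) i j / real M1))"

lemma drift_nonneg: "w \<in> space M \<Longrightarrow> drift n w \<ge> 0"
proof -
  assume "w \<in> space M"
  then interpret positive_array S1 S2 "V n w" by (rule positive_array_V)
  have "drift n w = (\<Sum>i\<in>S1. \<Sum>j\<in>S2. share S1 S2 (V n w) i j *
      (potential S1 S2 (reinforce i j (V n w)) - potential S1 S2 (V n w))) / real M1"
    by (simp add: drift_def increment_def sum_divide_distrib mult.commute)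
  \<comment> \<open>Here \<open>drift_nonneg\<close> is the inequality for positive arrays,
    interpreted at \<open>V n w\<close>.\<close>
  then show ?thesis using drift_nonneg by simp
qed

lemma measurable_increment_past: "i \<in> S1 \<Longrightarrow> j \<in> S2 \<Longrightarrow> increment n i j \<in> borel_measurable (past n)"
  unfolding increment_def
  by (intro borel_measurable_diff measurable_potential_past measurable_potential_reinforce_past)

lemma increment_bounded: 
  assumes "w \<in> space M" shows "\<bar>increment n i j w\<bar> \<le> real (M1 * M2)"
proof -
  interpret positive_array S1 S2 "V n w" using assms by (rule positive_array_V)
  interpret R: positive_array S1 S2 "reinforce i j (V n w)" by (rule positive_array_reinforce)
  show ?thesis
    using potential_nonneg potential_le R.potential_nonneg R.potential_le card_S1 card_S2
    by (simp add: increment_def abs_le_iff)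
qed

text \<open>Only the event for the drawn state and signal can occur, and it does so exactly when the
  act matches the state; otherwise both sides vanish.\<close>

lemma potential_step:
  assumes w: "w \<in> space M"
  shows "potential S1 S2 (V (Suc n) w) - potential S1 S2 (V n w) = (\<Sum>i\<in>S1. \<Sum>j\<in>S2.
    increment n i j w * indicator {w \<in> space M. st n w = i \<and> sg n w = j \<and> act n w = i} w)"
proof -
  have "(\<Sum>i\<in>S1. \<Sum>j\<in>S2.
      increment n i j w * indicator {w \<in> space M. st n w = i \<and> sg n w = j \<and> act n w = i} w)
    = (\<Sum>i\<in>S1. if i = st n w then \<Sum>j\<in>S2. if j = sg n w then increment n i j w * of_bool (act n w = i) else 0 else 0)"
    using w by (intro sum.cong refl) (auto intro!: sum.cong sum.neutral simp: indicator_def)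
  also have "\<dots> = increment n (st n w) (sg n w) w * of_bool (act n w = st n w)"
    using st_in[OF w] sg_in[OF w] finite_S1 finite_S2 by simp
  also have "\<dots> = potential S1 S2 (V (Suc n) w) - potential S1 S2 (V n w)"
  proof (cases "act n w = st n w")
    case True
    then have "potential S1 S2 (V (Suc n) w) = potential S1 S2 (reinforce (st n w) (sg n w) (V n w))"
      using w V_step by (intro potential_cong) (auto simp: reinforce_def)
    then show ?thesis using True by (simp add: increment_def)
  next
    case False
    then have "potential S1 S2 (V (Suc n) w) = potential S1 S2 (V n w)"
      using w V_step by (intro potential_cong) auto
    then show ?thesis using False by simp
  qed
  finally show ?thesis by simp
qed

lemma potential_bounded: "w \<in> space M \<Longrightarrow> \<bar>potential S1 S2 (V n w)\<bar> \<le> real (M1 * M2)"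
proof -
  assume "w \<in> space M"
  then interpret positive_array S1 S2 "V n w" by (rule positive_array_V)
  show ?thesis using potential_nonneg potential_le card_S1 card_S2 by simp
qed

lemma integrable_potential: "integrable M (\<lambda>w. potential S1 S2 (V n w))"
proof (rule integrable_if_bounded)
  show "(\<lambda>w. potential S1 S2 (V n w)) \<in> borel_measurable M"
    by (rule measurable_from_subalg[OF subalgebra_past measurable_potential_past])
qed (rule potential_bounded)

lemma integrable_drift_term:
  assumes i: "i \<in> S1" and j: "j \<in> S2"
  shows "integrable M (\<lambda>w. increment n i j w * (share S1 S2 (V n w) i j / real M1))"
proof (rule integrable_if_bounded)
  show "(\<lambda>w. increment n i j w * (share S1 S2 (V n w) i j / real M1)) \<in> borel_measurable M"
    using measurable_increment_past[OF i j] measurable_share_past[OF i j]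
    by (intro measurable_from_subalg[OF subalgebra_past[of n]]) simp
  fix w assume w: "w \<in> space M"
  then interpret positive_array S1 S2 "V n w" by (rule positive_array_V)
  have "share S1 S2 (V n w) i j / real M1 \<le> 1" "0 \<le> share S1 S2 (V n w) i j / real M1"
    using share_nonneg[OF i j] share_le_1[OF i j] M1_pos by (auto simp: divide_le_eq_1)
  then show "\<bar>increment n i j w * (share S1 S2 (V n w) i j / real M1)\<bar> \<le> real (M1 * M2) * 1"
    unfolding abs_mult using increment_bounded[OF w] by (intro mult_mono) auto
qed

lemma integrable_drift: "integrable M (drift n)"
  unfolding drift_def[abs_def] by (intro Bochner_Integration.integrable_sum integrable_drift_term)

text \<open>Testing on the sets of \<open>past n\<close> identifies the drift: split the step by the
  reinforced entry and apply \<open>integral_reinforced\<close> with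
  \<open>indicator A w * increment n i j w\<close> as the known factor.\<close>

lemma integral_potential_step:
  assumes A: "A \<in> sets (past n)"
  shows "(\<integral>w. indicator A w * (potential S1 S2 (V (Suc n) w) - potential S1 S2 (V n w)) \<partial>M)
    = (\<integral>w. indicator A w * drift n w \<partial>M)"
proof -
  let ?E = "\<lambda>i j. {w \<in> space M. st n w = i \<and> sg n w = j \<and> act n w = i}"
  note [measurable] = pred_eq_count_space[OF state_measurable] pred_eq_count_space[OF signal_measurable]
    pred_eq_count_space[OF act_measurable]
  have AM: "A \<in> sets M" using A subalgebra_past by (auto simp: subalgebra_def)
  have f: "(\<lambda>w. indicator A w * increment n i j w) \<in> borel_measurable (past n)"
    if "i \<in> S1" "j \<in> S2" for i j
    using A measurable_increment_past[OF that] by simp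
  have B: "\<bar>indicator A w * increment n i j w\<bar> \<le> real (M1 * M2)" if "w \<in> space M" for w i j
    using increment_bounded[OF that, of n i j] by (auto simp: indicator_def)
  have int1: "integrable M (\<lambda>w. indicator A w * increment n i j w * indicator (?E i j) w)"
    if ij: "i \<in> S1" "j \<in> S2" for i j
  proof (rule integrable_if_bounded)
    note [measurable] = measurable_from_subalg[OF subalgebra_past f[OF ij]]
    show "(\<lambda>w. indicator A w * increment n i j w * indicator (?E i j) w) \<in> borel_measurable M"
      by measurable
    fix w assume "w \<in> space M"
    then show "\<bar>indicator A w * increment n i j w * indicator (?E i j) w\<bar> \<le> real (M1 * M2)"
      using B[of w i j] by (auto simp: indicator_def)
  qed
  have int2: "integrable M (\<lambda>w. indicator A w * increment n i j w * (share S1 S2 (V n w) i j / real M1))"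
    if ij: "i \<in> S1" "j \<in> S2" for i j
    using integrable_mult_indicator[OF AM integrable_drift_term[OF ij]] by (simp add: mult.assoc)
  have "(\<integral>w. indicator A w * (potential S1 S2 (V (Suc n) w) - potential S1 S2 (V n w)) \<partial>M)
      = (\<integral>w. (\<Sum>i\<in>S1. \<Sum>j\<in>S2. indicator A w * increment n i j w * indicator (?E i j) w) \<partial>M)"
    by (intro Bochner_Integration.integral_cong refl)
      (simp add: potential_step sum_distrib_left mult.assoc)
  also have "\<dots> = (\<Sum>i\<in>S1. \<Sum>j\<in>S2. \<integral>w. indicator A w * increment n i j w * indicator (?E i j) w \<partial>M)"
    using int1 by (simp add: Bochner_Integration.integral_sum Bochner_Integration.integrable_sum)
  also have "\<dots> = (\<Sum>i\<in>S1. \<Sum>j\<in>S2. \<integral>w. indicator A w * increment n i j w * (share S1 S2 (V n w) i j / real M1) \<partial>M)"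
  proof (intro sum.cong refl)
    fix i j assume ij: "i \<in> S1" "j \<in> S2"
    show "(\<integral>w. indicator A w * increment n i j w * indicator (?E i j) w \<partial>M)
        = (\<integral>w. indicator A w * increment n i j w * (share S1 S2 (V n w) i j / real M1) \<partial>M)"
      using ij f[OF ij] B by (rule integral_reinforced)
  qed
  also have "\<dots> = (\<integral>w. (\<Sum>i\<in>S1. \<Sum>j\<in>S2. indicator A w * increment n i j w * (share S1 S2 (V n w) i j / real M1)) \<partial>M)"
    using int2 by (simp add: Bochner_Integration.integral_sum Bochner_Integration.integrable_sum)
  also have "\<dots> = (\<integral>w. indicator A w * drift n w \<partial>M)"
    by (simp add: drift_def sum_distrib_left mult.assoc)
  finally show ?thesis .
qed

section \<open>The normalized process\<close>

lemma row_sum_S1: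
  assumes "i \<in> S1"
  shows "row_sum S1 S2 (sym_ext S1 S2 v) i = (\<Sum>j\<in>S2. v i j)"
proof -
  have "row_sum S1 S2 (sym_ext S1 S2 v) i
      = (\<Sum>j\<in>S1. sym_ext S1 S2 v i j) + (\<Sum>j\<in>S2. sym_ext S1 S2 v i j)"
    unfolding row_sum_def using finite_S1 finite_S2 disjoint by (rule sum.union_disjoint)
  moreover have "(\<Sum>j\<in>S1. sym_ext S1 S2 v i j) = 0"
    using assms disjoint by (intro sum.neutral) (auto simp: sym_ext_def)
  moreover have "(\<Sum>j\<in>S2. sym_ext S1 S2 v i j) = (\<Sum>j\<in>S2. v i j)"
    using assms by (intro sum.cong) (auto simp: sym_ext_def)
  ultimately show ?thesis by simp
qed

lemma row_sum_S2:
  assumes "j \<in> S2"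
  shows "row_sum S1 S2 (sym_ext S1 S2 v) j = (\<Sum>i\<in>S1. v i j)"
proof -
  have "row_sum S1 S2 (sym_ext S1 S2 v) j
      = (\<Sum>i\<in>S1. sym_ext S1 S2 v j i) + (\<Sum>i\<in>S2. sym_ext S1 S2 v j i)"
    unfolding row_sum_def using finite_S1 finite_S2 disjoint by (rule sum.union_disjoint)
  moreover have "(\<Sum>i\<in>S2. sym_ext S1 S2 v j i) = 0"
    using assms disjoint by (intro sum.neutral) (auto simp: sym_ext_def)
  moreover have "(\<Sum>i\<in>S1. sym_ext S1 S2 v j i) = (\<Sum>i\<in>S1. v i j)"
    using assms disjoint by (intro sum.cong) (auto simp: sym_ext_def)
  ultimately show ?thesis by simp
qed

lemma total_weight_pos:
  assumes "w \<in> space M"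
  shows "total_weight S1 S2 (sym_ext S1 S2 (V n w)) > 0"
proof -
  interpret positive_array S1 S2 "V n w" using assms by (rule positive_array_V)
  have "(\<Sum>i\<in>S1. \<Sum>j\<in>S2. V n w i j) > 0"
    using finite_S1 S1_nonempty by (rule sum_pos) (use S2_nonempty row_pos in blast)
  then show ?thesis
    by (simp add: total_weight_def row_sum_S1)
qed

lemma normalized_process_pos:
  assumes "w \<in> space M" "i \<in> S1" "j \<in> S2"
  shows "normalized_process S1 S2 V n w i j > 0"
  using total_weight_pos[OF assms(1)] V_ge_1[OF assms, of n] assms
  by (simp add: normalized_process_def sym_ext_def)

text \<open>All entries are positive, so the sum runs over all of \<open>S1 \<times> S2\<close>. It
  stays in terms of the normalized process, because measurability is needed for the filtration of
  that process.\<close>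

lemma communication_potential_eq_sum:
  assumes "w \<in> space M"
  shows "communication_potential S1 S2 (normalized_process S1 S2 V n w) =
    (\<Sum>i\<in>S1. \<Sum>j\<in>S2. (normalized_process S1 S2 V n w i j)\<^sup>2 /
      (row_sum S1 S2 (normalized_process S1 S2 V n w) i * row_sum S1 S2 (normalized_process S1 S2 V n w) j))"
proof -
  have "{(i, j). i \<in> S1 \<and> j \<in> S2 \<and> normalized_process S1 S2 V n w i j > 0} = S1 \<times> S2"
    using normalized_process_pos[OF assms] by auto
  then show ?thesis
    by (simp add: communication_potential_def sum.cartesian_product)
qed

text \<open>Numerator and denominator of each summand both carry the factor \<open>1 / ?T\<close>
  squared.\<close>

lemma communication_potential_eq_potential:
  assumes w: "w \<in> space M"
  shows "communication_potential S1 S2 (normalized_process S1 S2 V n w) = potential S1 S2 (V n w)"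
proof -
  let ?T = "total_weight S1 S2 (sym_ext S1 S2 (V n w))"
  have row: "row_sum S1 S2 (normalized_process S1 S2 V n w) i = row_sum S1 S2 (sym_ext S1 S2 (V n w)) i / ?T" for i
    by (simp add: row_sum_def normalized_process_def sum_divide_distrib)
  show ?thesis
    unfolding communication_potential_eq_sum[OF w] potential_def share_def row
    using total_weight_pos[OF w, of n]
    by (intro sum.cong refl)
      (simp add: row_sum_S1 row_sum_S2 normalized_process_def sym_ext_def power2_eq_square)
qed

section \<open>The filtration of the normalized process and the submartingale property\<close>

lemma measurable_normalized_past:
  assumes "m \<le> n"
  shows "(\<lambda>w. normalized_process S1 S2 V m w i j) \<in> borel_measurable (past n)"
proof -
  have [measurable]: "(\<lambda>w. sym_ext S1 S2 (V m w) i j) \<in> borel_measurable (past n)" for i j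
    using measurable_V_past[OF _ _ assms] by (cases "i \<in> S1 \<and> j \<in> S2"; cases "i \<in> S2 \<and> j \<in> S1") (auto simp: sym_ext_def)
  show ?thesis
    unfolding normalized_process_def total_weight_def row_sum_def by measurable
qed

lemma normalized_filtration_le_past: "subalgebra (past n) (normalized_filtration M S1 S2 V n)"
  unfolding normalized_filtration_def
  by (rule subalgebra_array_history_algebra) (auto intro: measurable_normalized_past)

lemma filtration_normalized: "filtration (space M) (normalized_filtration M S1 S2 V)"
proof
  fix i j :: nat assume "i \<le> j"
  then have "subalgebra (normalized_filtration M S1 S2 V j) (normalized_filtration M S1 S2 V i)"
    unfolding normalized_filtration_def
    by (intro subalgebra_array_history_algebra measurable_array_history_algebra) auto
  then show "sets (normalized_filtration M S1 S2 V i) \<subseteq> sets (normalized_filtration M S1 S2 V j)"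
    by (simp add: subalgebra_def)
qed (simp add: normalized_filtration_def)

lemma measurable_communication_potential:
  "(\<lambda>w. communication_potential S1 S2 (normalized_process S1 S2 V n w))
    \<in> borel_measurable (normalized_filtration M S1 S2 V n)"
proof (cases n)
  case 0
  \<comment> \<open>The filtration starts from \<open>x_1\<close> and is trivial at time 0;
    measurability there comes from the deterministic initial weights.\<close>
  have "communication_potential S1 S2 (normalized_process S1 S2 V 0 w) = potential S1 S2 (\<lambda>_ _. 1)"
    if "w \<in> space M" for w
    unfolding communication_potential_eq_potential[OF that]
    using that V_init by (intro potential_cong) auto
  then show ?thesis
    unfolding 0 by (subst measurable_cong) (auto simp: normalized_filtration_def)
next
  case (Suc m)
  have x: "(\<lambda>w. normalized_process S1 S2 V n w i j) \<in> borel_measurable (normalized_filtration M S1 S2 V n)"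
    if "i \<in> S1 \<union> S2" "j \<in> S1 \<union> S2" for i j
    unfolding normalized_filtration_def using that Suc by (intro measurable_array_history_algebra) auto
  have "(\<lambda>w. \<Sum>i\<in>S1. \<Sum>j\<in>S2. (normalized_process S1 S2 V n w i j)\<^sup>2 /
      (row_sum S1 S2 (normalized_process S1 S2 V n w) i * row_sum S1 S2 (normalized_process S1 S2 V n w) j))
      \<in> borel_measurable (normalized_filtration M S1 S2 V n)"
    unfolding row_sum_def
    by (intro borel_measurable_sum borel_measurable_divide borel_measurable_times borel_measurable_power x) auto
  then show ?thesis
    by (subst measurable_cong[OF communication_potential_eq_sum]) (auto simp: normalized_filtration_def)
qed

lemma submartingale_communication_potential:
  "submartingale M (normalized_filtration M S1 S2 V)
    (\<lambda>n w. communication_potential S1 S2 (normalized_process S1 S2 V n w))"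
proof -
  let ?F = "normalized_filtration M S1 S2 V"
  let ?H = "\<lambda>n w. communication_potential S1 S2 (normalized_process S1 S2 V n w)"
  have sub: "subalgebra M (?F n)" for n
    using subalgebra_past[of n] normalized_filtration_le_past[of n] by (auto simp: subalgebra_def)
  have int: "integrable M (?H n)" for n
    by (subst Bochner_Integration.integrable_cong[OF refl communication_potential_eq_potential])
      (auto intro: integrable_potential)
  have "AE w in M. ?H n w \<le> real_cond_exp M (?F n) (?H (Suc n)) w" for n
  \<comment> \<open>Every set of the smaller algebra lies in \<open>past n\<close>, so the drift
    identity applies to it.\<close>
  proof (rule cond_exp_increment_nonneg[where D = "drift n"])
    fix A assume "A \<in> sets (?F n)"
    then have "A \<in> sets (past n)"
      using normalized_filtration_le_past by (auto simp: subalgebra_def)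
    from integral_potential_step[OF this]
    show "(\<integral>w. indicator A w * (?H (Suc n) w - ?H n w) \<partial>M) = (\<integral>w. indicator A w * drift n w \<partial>M)"
      by (simp add: communication_potential_eq_potential cong: Bochner_Integration.integral_cong)
  qed (use sub int integrable_drift drift_nonneg measurable_communication_potential in auto)
  then show ?thesis
    unfolding submartingale_def
    using filtration_normalized sub measurable_communication_potential int by blast
qed

lemma bounded_communication_potential:
  "bounded_process M (\<lambda>n w. communication_potential S1 S2 (normalized_process S1 S2 V n w))"
  unfolding bounded_process_def using potential_bounded
  by (intro exI[of _ "real (M1 * M2)"]) (simp add: communication_potential_eq_potential)

end

theorem theorem2p1:
  fixes M :: "'w measure"
    and M1 M2 :: nat
    and S1 S2 :: "'s set"
    and V :: "nat \<Rightarrow> 'w \<Rightarrow> 's \<Rightarrow> 's \<Rightarrow> real"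
    and st sg act :: "nat \<Rightarrow> 'w \<Rightarrow> 's"
  assumes "signaling_process M M1 M2 S1 S2 V st sg act"
  defines "H \<equiv> (\<lambda>n w. communication_potential S1 S2 (normalized_process S1 S2 V n w))"
  shows "submartingale M (normalized_filtration M S1 S2 V) H
       \<and> bounded_process M H
       \<and> (AE w in M. convergent (\<lambda>n. H n w))"
proof -
  interpret signaling_process M M1 M2 S1 S2 V st sg act by fact
  show ?thesis
    unfolding H_def
    using submartingale_communication_potential bounded_communication_potential
      bounded_submartingale_AE_convergent by blast
qed

end
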